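(* Let $x_k\in\mathcal X_0$ and let $F(\cdot;x_k)$ be the convex model of $F$ at $x_k$. Set $$L_U:=L_h\beta_C+L_R^2\beta_s,\qquad L_L:=L_U+L_s\beta_R .$$ Then for all $x\in\mathbb R^m$ with $g(x)<+\infty$, $$-\frac{L_L}{2}\|x-x_k\|^2\ \le\ F(x)-F(x;x_k)\ \le\ \frac{L_U}{2}\|x-x_k\|^2 .$$
   Context: **Problem.** $F(x)=g(x)+h(C(x))+s(R(x))$ on $\mathbb R^m$, where $g:\mathbb R^m\to\mathbb R\cup\{+\infty\}$ is proper, closed, convex; $h:\mathbb R^d\to\mathbb R$ is finite-valued, closed, convex; $C:\mathbb R^m\to\mathbb R^d$ and $s:\mathbb R^n\to\mathbb R$ are $\mathcal C^1$; $R=(r_1,\dots,r_n)$ with each $r_i:\mathbb R^m\to\mathbb R$ finite-valued, closed, convex. $\|\cdot\|$ is the Euclidean norm on vectors and the spectral norm on matrices. **Standing assumptions.** (1) Monotone-or-smooth: for each $\bar x\in\operatorname{dom}F$ there is a neighborhood $W$ of $R(\bar x)$ such that, for every $i$, if $r_i$ is not $\mathcal C^1$ on any neighborhood of $\bar x$ then $\nabla_i s(z)\ge0$ for all $z\in W$. (2) A starting point $x_0\in\operatorname{dom}F$ is fixed, and $\mathcal X_0:=\{x\in\operatorname{dom}F: F(x)\le F(x_0)\}$ is nonempty and compact. (3) $h$ is $L_h$-Lipschitz; $C$ has $\beta_C$-Lipschitz Jacobian; $s$ has $\beta_s$-Lipschitz gradient; each $r_i$ is $L_{r_i}$-Lipschitz,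 and $L_R:=\|(L_{r_1},\dots,L_{r_n})\|_2$, so $R$ is $L_R$-Lipschitz. (4) Let $\mathcal I^-$ be the set of indices $i$ with $\nabla_i s(R(x))<0$ for some $x\in\mathcal X_0$. If $\mathcal I^-\ne\emptyset$, then $\|\nabla s(y)\|\le L_s$ for all $y\in\{R(x):F(x)\le F(x_0)\}$, and each $r_i$, $i\in\mathcal I^-$, is $\mathcal C^1$ with $\beta_{r_i}$-Lipschitz gradient; $\beta_R:=(\sum_{i\in\mathcal I^-}\beta_{r_i}^2)^{1/2}$. If $\mathcal I^-=\emptyset$, then $\beta_R=0$ and $L_s\beta_R$ is read as $0$. **Model.** For $x_k\in\mathcal X_0$, $$F(x;x_k)=g(x)+h\big(C(x_k)+\nabla C(x_k)(x-x_k)\big)+s(R(x_k))+\sum_{i=1}^n\nabla_i s(R(x_k))\,\Phi_i(x;x_k),$$ where $\Phi_i(x;x_k)=r_i(x)-r_i(x_k)$ if $\nabla_i s(R(x_k))\ge0$, and $\Phi_i(x;x_k)=\nabla r_i(x_k)^\top(x-x_k)$ if $\nabla_i s(R(x_k))<0$. *)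

theory Defs
  imports "HOL-Analysis.Analysis"
begin

text \<open>
  Functions with values in \<open>(-\<infinity>, +\<infinity>]\<close> are modelled as \<open>ereal\<close>-valued functions that are
  \<open>ereal_proper\<close>. The epigraph keeps only real heights, as is usual in convex analysis;
  the library's \<open>epigraph\<close> and \<open>convex_on\<close> cover finite-valued functions only.
\<close>

definition ereal_epigraph :: "('a \<Rightarrow> ereal) \<Rightarrow> ('a \<times> real) set" where
  "ereal_epigraph f = {(x, t). f x \<le> ereal t}"

definition ereal_domain :: "('a \<Rightarrow> ereal) \<Rightarrow> 'a set" where
  "ereal_domain f = {x. f x < \<infinity>}"

definition ereal_proper :: "('a \<Rightarrow> ereal) \<Rightarrow> bool" where
  "ereal_proper f \<longleftrightarrow> ereal_domain f \<noteq> {} \<and> (\<forall>x. f x \<noteq> -\<infinity>)"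

definition ereal_closed :: "('a::topological_space \<Rightarrow> ereal) \<Rightarrow> bool" where
  "ereal_closed f \<longleftrightarrow> closed (ereal_epigraph f)"

definition ereal_convex :: "('a::real_vector \<Rightarrow> ereal) \<Rightarrow> bool" where
  "ereal_convex f \<longleftrightarrow> convex (ereal_epigraph f)"

definition finite_closed_convex :: "('a::real_normed_vector \<Rightarrow> real) \<Rightarrow> bool" where
  "finite_closed_convex f \<longleftrightarrow> closed (epigraph UNIV f) \<and> convex_on UNIV f"

definition C1_on ::
  "'a set \<Rightarrow> ('a::real_normed_vector \<Rightarrow> 'b::real_normed_vector) \<Rightarrow> bool" where
  "C1_on S f \<longleftrightarrow> open S \<and>
     (\<exists>f'. (\<forall>x\<in>S. (f has_derivative blinfun_apply (f' x)) (at x)) \<and> continuous_on S f')"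

text \<open>Meaningful only at points of differentiability, where the gradient is unique.\<close>

definition gradient :: "('a::real_inner \<Rightarrow> real) \<Rightarrow> 'a \<Rightarrow> 'a" where
  "gradient f x = (THE D. GDERIV f x :> D)"

text \<open>
  The spectral norm is the operator norm induced by the Euclidean norms. The type-class norm
  on \<open>real ^ 'n ^ 'm\<close> is the Frobenius norm instead.
\<close>

definition spectral_norm :: "real ^ 'n ^ 'm \<Rightarrow> real" where
  "spectral_norm A = onorm ((*v) A)"

definition vector_map :: "('n::finite \<Rightarrow> 'a \<Rightarrow> real) \<Rightarrow> 'a \<Rightarrow> real ^ 'n" where
  "vector_map r x = (\<chi> i. r i x)"

definition objective ::
  "(real ^ 'm \<Rightarrow> ereal) \<Rightarrow> (real ^ 'd \<Rightarrow> real) \<Rightarrow> (real ^ 'm \<Rightarrow> real ^ 'd) \<Rightarrow>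
   (real ^ 'n \<Rightarrow> real) \<Rightarrow> ('n \<Rightarrow> real ^ 'm \<Rightarrow> real) \<Rightarrow> real ^ 'm \<Rightarrow> ereal" where
  "objective g h C s r x = g x + ereal (h (C x)) + ereal (s (vector_map r x))"

definition initial_level_set :: "('a \<Rightarrow> ereal) \<Rightarrow> 'a \<Rightarrow> 'a set" where
  "initial_level_set F x0 = {x \<in> ereal_domain F. F x \<le> F x0}"

definition neg_indices ::
  "(real ^ 'n \<Rightarrow> real) \<Rightarrow> ('n \<Rightarrow> 'a \<Rightarrow> real) \<Rightarrow> 'a set \<Rightarrow> 'n set" where
  "neg_indices s r X = {i. \<exists>x\<in>X. gradient s (vector_map r x) $ i < 0}"

text \<open>\<open>model_term s r xk i x\<close> is \<open>\<Phi>\<^sub>i(x; xk)\<close>, and \<open>model g h C s r xk x\<close> is \<open>F(x; xk)\<close>.\<close>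

definition model_term ::
  "(real ^ 'n \<Rightarrow> real) \<Rightarrow> ('n \<Rightarrow> real ^ 'm \<Rightarrow> real) \<Rightarrow>
   real ^ 'm \<Rightarrow> 'n \<Rightarrow> real ^ 'm \<Rightarrow> real" where
  "model_term s r xk i x =
     (if gradient s (vector_map r xk) $ i \<ge> 0 then r i x - r i xk
      else gradient (r i) xk \<bullet> (x - xk))"

definition model ::
  "(real ^ 'm \<Rightarrow> ereal) \<Rightarrow> (real ^ 'd \<Rightarrow> real) \<Rightarrow> (real ^ 'm \<Rightarrow> real ^ 'd) \<Rightarrow>
   (real ^ 'n \<Rightarrow> real) \<Rightarrow> ('n \<Rightarrow> real ^ 'm \<Rightarrow> real) \<Rightarrow>
   real ^ 'm \<Rightarrow> real ^ 'm \<Rightarrow> ereal" where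
  "model g h C s r xk x =
     g x + ereal (h (C xk + jacobian C (at xk) *v (x - xk)))
         + ereal (s (vector_map r xk))
         + ereal (\<Sum>i\<in>UNIV. gradient s (vector_map r xk) $ i * model_term s r xk i x)"

end

theory Submission
  imports Defs
begin

text \<open>
  Both inequalities come from splitting \<open>F x - F(x; xk)\<close>, in which \<open>g x\<close> cancels, into
  three errors:
  \<^item> \<open>h\<close> at \<open>C x\<close> against \<open>h\<close> at the linearization of \<open>C\<close>;
  \<^item> the linearization error of \<open>s\<close> between \<open>R xk\<close> and \<open>R x\<close>;
  \<^item> the sum over the indices with \<open>\<nabla>\<^sub>i s (R xk) < 0\<close> of \<open>\<nabla>\<^sub>i s (R xk)\<close> times the
    linearization error of \<open>r\<^sub>i\<close>; at the remaining indices the model keeps \<open>r\<^sub>i\<close> itself.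

  The linearization error of a map whose derivative is \<open>L\<close>-Lipschitz is at most
  \<open>L / 2 * d\<^sup>2\<close> at distance \<open>d\<close> (\<open>norm_linearization_error_le\<close>). Lipschitz continuity of
  \<open>h\<close> turns this into a bound on the first error, with coefficient \<open>L\<^sub>h \<beta>\<^sub>C / 2\<close> at
  \<open>\<parallel>x - xk\<parallel>\<^sup>2\<close>, and Lipschitz continuity of \<open>R\<close> (\<open>norm_vector_map_diff_le\<close>) gives the
  coefficient \<open>L\<^sub>R\<^sup>2 \<beta>\<^sub>s / 2\<close> for the second; both bounds hold in absolute value. The third error is one-sided: a convex function lies above its tangents
  (\<open>convex_on_above_tangent_plane\<close>), so each summand is a negative number times a
  nonnegative one and the sum does not enter the upper bound. From below the Cauchy-Schwarz
  inequality bounds it with coefficient \<open>- \<parallel>\<nabla>s (R xk)\<parallel> \<beta>\<^sub>R / 2\<close>, which accounts for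
  \<open>L\<^sub>L - L\<^sub>U = L\<^sub>s \<beta>\<^sub>R\<close>.
\<close>

section \<open>Linearization errors\<close>

text \<open>
  Along the segment from \<open>x\<close> to \<open>y\<close>, the error at parameter \<open>t\<close> has a derivative of norm at
  most \<open>L t \<parallel>y - x\<parallel>\<^sup>2\<close>, and the factor one half is the integral of \<open>t\<close> over the unit
  interval.
\<close>

lemma norm_linearization_error_le:
  fixes f :: "'a::real_normed_vector \<Rightarrow> 'b::real_normed_vector"
  assumes deriv: "\<And>z. (f has_derivative f' z) (at z)"
    and lip: "\<And>z v. norm (f' z v - f' x v) \<le> L * norm (z - x) * norm v"
  shows "norm (f y - f x - f' x (y - x)) \<le> L / 2 * (norm (y - x))\<^sup>2"
proof -
  define d where "d = y - x"
  define \<psi> where "\<psi> t = f (x + t *\<^sub>R d) - t *\<^sub>R f' x d" for t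
  define \<phi> where "\<phi> t = L / 2 * (norm d)\<^sup>2 * t\<^sup>2" for t
  have \<psi>: "(\<psi> has_vector_derivative (f' (x + t *\<^sub>R d) d - f' x d)) (at t)" for t
  proof -
    have line: "((\<lambda>t. x + t *\<^sub>R d) has_derivative (\<lambda>\<tau>. \<tau> *\<^sub>R d)) (at t)"
      by (auto intro!: derivative_eq_intros)
    have lin: "linear (f' (x + t *\<^sub>R d))"
      using deriv has_derivative_linear by blast
    have "(\<psi> has_derivative (\<lambda>\<tau>. f' (x + t *\<^sub>R d) (\<tau> *\<^sub>R d) - \<tau> *\<^sub>R f' x d)) (at t)"
      unfolding \<psi>_def
      by (rule has_derivative_diff[OF has_derivative_compose[OF line deriv]])
        (auto intro!: derivative_eq_intros)
    then show ?thesis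
      by (simp add: has_vector_derivative_def linear_scale[OF lin] scaleR_diff_right)
  qed
  have \<phi>: "(\<phi> has_vector_derivative (L * (norm d)\<^sup>2 * t)) (at t)" for t
    unfolding \<phi>_def has_real_derivative_iff_has_vector_derivative[symmetric]
    by (auto intro!: derivative_eq_intros)
  have "norm (\<psi> 1 - \<psi> 0) \<le> \<phi> 1 - \<phi> 0"
  proof (rule differentiable_bound_general[OF _ _ _ \<psi> \<phi>])
    show "continuous_on {0..1} \<psi>" "continuous_on {0..1} \<phi>"
      using \<psi> \<phi> by (auto intro!: continuous_at_imp_continuous_on
        has_vector_derivative_continuous)
    show "norm (f' (x + t *\<^sub>R d) d - f' x d) \<le> L * (norm d)\<^sup>2 * t" if "0 < t" for t :: real
      using lip[of "x + t *\<^sub>R d" d] that by (simp add: power2_eq_square mult_ac)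
  qed simp
  then show ?thesis
    by (simp add: \<psi>_def \<phi>_def d_def algebra_simps)
qed

lemma C1_on_imp_differentiable:
  assumes "C1_on S f" "x \<in> S"
  shows "f differentiable (at x)"
  using assms unfolding C1_on_def differentiable_def by blast

text \<open>
  The definite description in the definition of the gradient denotes the Riesz representative
  of the derivative, which the standard basis gives explicitly.
\<close>

lemma GDERIV_gradient:
  fixes f :: "'a::euclidean_space \<Rightarrow> real"
  assumes "f differentiable (at x)"
  shows "GDERIV f x :> gradient f x"
proof -
  obtain f' where f': "(f has_derivative f') (at x)"
    using assms by (auto simp: differentiable_def)
  define D where "D = (\<Sum>b\<in>Basis. f' b *\<^sub>R b)"
  have lin: "linear f'" using f' by (rule has_derivative_linear)
  have "f' v = v \<bullet> D" for v
  proof -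
    have "f' v = f' (\<Sum>b\<in>Basis. (v \<bullet> b) *\<^sub>R b)" by (simp add: euclidean_representation)
    also have "\<dots> = v \<bullet> D"
      by (simp add: linear_sum[OF lin] linear_scale[OF lin] D_def inner_sum_right mult.commute)
    finally show ?thesis .
  qed
  then have "f' = (\<lambda>v. v \<bullet> D)" by (rule ext)
  with f' have D: "GDERIV f x :> D" by (simp add: gderiv_def)
  moreover have "D' = D" if "GDERIV f x :> D'" for D'
  proof -
    have "(\<lambda>v. v \<bullet> D') = (\<lambda>v. v \<bullet> D)"
      using that D unfolding gderiv_def by (rule has_derivative_unique)
    then have "\<forall>v. v \<bullet> D' = v \<bullet> D" unfolding fun_eq_iff .
    then show ?thesis by (rule vector_eq_ldot[THEN iffD1])
  qed
  ultimately show ?thesis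
    unfolding gradient_def by (rule theI)
qed

lemma abs_gradient_linearization_error_le:
  fixes f :: "'a::euclidean_space \<Rightarrow> real"
  assumes f: "C1_on UNIV f" and lip: "L-lipschitz_on UNIV (gradient f)"
  shows "\<bar>f y - f x - gradient f x \<bullet> (y - x)\<bar> \<le> L / 2 * (norm (y - x))\<^sup>2"
proof -
  have "(f has_derivative (\<lambda>v. v \<bullet> gradient f z)) (at z)" for z
    using GDERIV_gradient[OF C1_on_imp_differentiable[OF f]] by (simp add: gderiv_def)
  moreover have "norm (v \<bullet> gradient f z - v \<bullet> gradient f x) \<le> L * norm (z - x) * norm v" for z v
  proof -
    have "norm (v \<bullet> gradient f z - v \<bullet> gradient f x) \<le> norm v * norm (gradient f z - gradient f x)"
      by (metis Cauchy_Schwarz_ineq2 inner_diff_right real_norm_def)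
    also have "\<dots> \<le> norm v * (L * norm (z - x))"
      using lipschitz_onD[OF lip, of z x] by (intro mult_left_mono) (auto simp: dist_norm)
    finally show ?thesis by (simp add: mult_ac)
  qed
  ultimately show ?thesis
    using norm_linearization_error_le[of f "\<lambda>z v. v \<bullet> gradient f z" x L y]
    by (simp add: inner_commute)
qed

lemma norm_jacobian_linearization_error_le:
  fixes f :: "real ^ 'm \<Rightarrow> real ^ 'd"
  assumes f: "C1_on UNIV f"
    and lip: "\<And>z. spectral_norm (jacobian f (at z) - jacobian f (at x)) \<le> L * norm (z - x)"
  shows "norm (f y - f x - jacobian f (at x) *v (y - x)) \<le> L / 2 * (norm (y - x))\<^sup>2"
proof (rule norm_linearization_error_le)
  show "(f has_derivative (*v) (jacobian f (at z))) (at z)" for z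
    using C1_on_imp_differentiable[OF f] jacobian_works by blast
  show "norm (jacobian f (at z) *v v - jacobian f (at x) *v v) \<le> L * norm (z - x) * norm v" for z v
  proof -
    have "norm (jacobian f (at z) *v v - jacobian f (at x) *v v) \<le>
        spectral_norm (jacobian f (at z) - jacobian f (at x)) * norm v"
      unfolding spectral_norm_def matrix_vector_mult_diff_rdistrib[symmetric]
      by (rule onorm) simp
    also have "\<dots> \<le> L * norm (z - x) * norm v"
      by (intro mult_right_mono lip) simp
    finally show ?thesis .
  qed
qed

section \<open>Convexity and vectors of Lipschitz functions\<close>

text \<open>The one-dimensional tangent bound applies to the restriction of \<open>f\<close> to the line through
  \<open>x\<close> and \<open>y\<close>.\<close>

lemma convex_on_above_tangent_plane:
  fixes f :: "'a::real_inner \<Rightarrow> real"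
  assumes conv: "convex_on UNIV f" and grad: "GDERIV f x :> D"
  shows "f x + D \<bullet> (y - x) \<le> f y"
proof -
  define \<phi> where "\<phi> t = f (x + t *\<^sub>R (y - x))" for t
  have "convex_on UNIV \<phi>"
  proof (rule convex_onI)
    fix t a b :: real assume t: "0 < t" "t < 1"
    have "x + ((1 - t) *\<^sub>R a + t *\<^sub>R b) *\<^sub>R (y - x) =
        (1 - t) *\<^sub>R (x + a *\<^sub>R (y - x)) + t *\<^sub>R (x + b *\<^sub>R (y - x))"
      by (simp add: algebra_simps)
    then show "\<phi> ((1 - t) *\<^sub>R a + t *\<^sub>R b) \<le> (1 - t) * \<phi> a + t * \<phi> b"
      unfolding \<phi>_def using convex_onD[OF conv] t by simp
  qed simp
  moreover have "(\<phi> has_field_derivative D \<bullet> (y - x)) (at 0)"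
  proof -
    have line: "((\<lambda>t. x + t *\<^sub>R (y - x)) has_derivative (\<lambda>t. t *\<^sub>R (y - x))) (at 0)"
      by (auto intro!: derivative_eq_intros)
    have "(f has_derivative (\<lambda>v. v \<bullet> D)) (at (x + 0 *\<^sub>R (y - x)))"
      using grad by (simp add: gderiv_def)
    from has_derivative_compose[OF line this] show ?thesis
      unfolding \<phi>_def has_field_derivative_def
      by (rule has_derivative_eq_rhs) (auto simp: fun_eq_iff inner_commute mult.commute)
  qed
  ultimately have "\<phi> 1 - \<phi> 0 \<ge> D \<bullet> (y - x) * (1 - 0)"
    by (intro convex_on_imp_above_tangent) auto
  then show ?thesis by (simp add: \<phi>_def)
qed

lemma norm_vector_map_diff_le:
  fixes r :: "'n::finite \<Rightarrow> 'a::real_normed_vector \<Rightarrow> real"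
  assumes "\<And>i. (L i)-lipschitz_on UNIV (r i)"
  shows "norm (vector_map r x - vector_map r y) \<le> L2_set L UNIV * norm (x - y)"
proof -
  have "norm (vector_map r x - vector_map r y) \<le> L2_set (\<lambda>i. L i * norm (x - y)) UNIV"
    unfolding norm_vec_def
    using lipschitz_onD[OF assms, of x y]
    by (intro L2_set_mono) (auto simp: vector_map_def dist_norm)
  then show ?thesis by (simp add: L2_set_left_distrib)
qed

section \<open>The model error\<close>

theorem lemma3p1:
  fixes g :: "real ^ 'm \<Rightarrow> ereal"
    and h :: "real ^ 'd \<Rightarrow> real"
    and C :: "real ^ 'm \<Rightarrow> real ^ 'd"
    and s :: "real ^ 'n \<Rightarrow> real"
    and r :: "'n \<Rightarrow> real ^ 'm \<Rightarrow> real"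
    and F :: "real ^ 'm \<Rightarrow> ereal"
    and x0 xk :: "real ^ 'm"
    and X0 :: "(real ^ 'm) set"
    and I_neg :: "'n set"
    and L_r \<beta>_r :: "'n \<Rightarrow> real"
    and L_h \<beta>_C \<beta>_s L_s L_R \<beta>_R L_U L_L :: real
  assumes g: "ereal_proper g" "ereal_closed g" "ereal_convex g"
    and h: "finite_closed_convex h"
    and C: "C1_on UNIV C"
    and s: "C1_on UNIV s"
    and r: "\<And>i. finite_closed_convex (r i)"
    and F: "F = objective g h C s r"
    and monotone_or_smooth:
      "\<And>xbar. xbar \<in> ereal_domain F \<Longrightarrow>
         \<exists>W. open W \<and> vector_map r xbar \<in> W \<and>
           (\<forall>i. \<not> (\<exists>U. xbar \<in> U \<and> C1_on U (r i)) \<longrightarrow> (\<forall>z\<in>W. gradient s z $ i \<ge> 0))"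
    and x0: "x0 \<in> ereal_domain F"
    and X0: "X0 = initial_level_set F x0" "X0 \<noteq> {}" "compact X0"
    and h_lipschitz: "L_h-lipschitz_on UNIV h"
    and C_lipschitz:
      "\<And>x y. spectral_norm (jacobian C (at x) - jacobian C (at y)) \<le> \<beta>_C * norm (x - y)"
    and s_lipschitz: "\<beta>_s-lipschitz_on UNIV (gradient s)"
    and r_lipschitz: "\<And>i. (L_r i)-lipschitz_on UNIV (r i)"
    and L_R: "L_R = L2_set L_r UNIV"
    and I_neg: "I_neg = neg_indices s r X0"
    and s_bound:
      "I_neg \<noteq> {} \<Longrightarrow> \<forall>y \<in> vector_map r ` {x. F x \<le> F x0}. norm (gradient s y) \<le> L_s"
    and r_smooth:
      "\<And>i. i \<in> I_neg \<Longrightarrow> C1_on UNIV (r i) \<and> (\<beta>_r i)-lipschitz_on UNIV (gradient (r i))"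
    and \<beta>_R: "\<beta>_R = L2_set \<beta>_r I_neg"
    and L_U: "L_U = L_h * \<beta>_C + L_R\<^sup>2 * \<beta>_s"
    and L_L: "L_L = L_U + L_s * \<beta>_R"
    and xk: "xk \<in> X0"
  shows "\<forall>x. g x < \<infinity> \<longrightarrow>
           ereal (- (L_L / 2) * (norm (x - xk))\<^sup>2) \<le> F x - model g h C s r xk x \<and>
           F x - model g h C s r xk x \<le> ereal (L_U / 2 * (norm (x - xk))\<^sup>2)"
proof (intro allI impI)
  fix x assume gx: "g x < \<infinity>"
  obtain \<gamma> where \<gamma>: "g x = ereal \<gamma>"
    using gx g(1) by (cases "g x") (auto simp: ereal_proper_def)
  define R where "R = vector_map r"
  define w where "w = gradient s (R xk)"
  define q where "q = (norm (x - xk))\<^sup>2"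
  define e where "e i = r i x - r i xk - gradient (r i) xk \<bullet> (x - xk)" for i
  define A where "A = h (C x) - h (C xk + jacobian C (at xk) *v (x - xk))"
  define B where "B = s (R x) - s (R xk) - w \<bullet> (R x - R xk)"
  define N where "N = {i. w $ i < 0}"
  define E where "E = (\<Sum>i\<in>N. w $ i * e i)"
  have N: "N \<subseteq> I_neg"
    using xk unfolding N_def I_neg neg_indices_def w_def R_def by auto
  have q: "0 \<le> q" by (simp add: q_def)

  \<comment> \<open>Adding and subtracting \<open>w \<bullet> (R x - R xk)\<close> separates the linearization error of \<open>s\<close> from
    those of the \<open>r i\<close>; indices outside \<open>N\<close> cancel because the model keeps \<open>r i\<close> there.\<close>
  have "w \<bullet> (R x - R xk) - (\<Sum>i\<in>UNIV. w $ i * model_term s r xk i x) =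
      (\<Sum>i\<in>UNIV. w $ i * (r i x - r i xk - model_term s r xk i x))"
    by (simp add: inner_vec_def R_def vector_map_def sum_subtractf sum.distrib algebra_simps)
  also have "\<dots> = E"
    unfolding E_def
    by (intro sum.mono_neutral_cong_right)
      (auto simp: N_def e_def model_term_def w_def R_def)
  finally have error: "F x - model g h C s r xk x = ereal (A + B + E)"
    by (simp add: F objective_def model_def \<gamma> A_def B_def R_def[symmetric] w_def[symmetric])

  have A: "\<bar>A\<bar> \<le> L_h * \<beta>_C / 2 * q"
  proof -
    have "\<bar>A\<bar> \<le> L_h * norm (C x - C xk - jacobian C (at xk) *v (x - xk))"
      using lipschitz_onD[OF h_lipschitz, of "C x" "C xk + jacobian C (at xk) *v (x - xk)"]
      by (simp add: A_def dist_norm algebra_simps)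
    also have "\<dots> \<le> L_h * (\<beta>_C / 2 * q)"
      unfolding q_def using lipschitz_on_nonneg[OF h_lipschitz]
      by (intro mult_left_mono norm_jacobian_linearization_error_le C C_lipschitz)
    finally show ?thesis by simp
  qed

  have B: "\<bar>B\<bar> \<le> L_R\<^sup>2 * \<beta>_s / 2 * q"
  proof -
    have "\<bar>B\<bar> \<le> \<beta>_s / 2 * (norm (R x - R xk))\<^sup>2"
      unfolding B_def w_def by (rule abs_gradient_linearization_error_le[OF s s_lipschitz])
    also have "\<dots> \<le> \<beta>_s / 2 * (L_R * norm (x - xk))\<^sup>2"
      using lipschitz_on_nonneg[OF s_lipschitz]
      by (intro mult_left_mono power_mono)
        (auto simp: R_def L_R intro: norm_vector_map_diff_le r_lipschitz)
    finally show ?thesis by (simp add: q_def power_mult_distrib mult_ac)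
  qed

  have e_nonneg: "0 \<le> e i" if "i \<in> N" for i
  proof -
    have "convex_on UNIV (r i)" using r by (simp add: finite_closed_convex_def)
    moreover have "GDERIV (r i) xk :> gradient (r i) xk"
      using that N r_smooth by (intro GDERIV_gradient C1_on_imp_differentiable[of UNIV]) auto
    ultimately show ?thesis
      using convex_on_above_tangent_plane[of "r i" xk "gradient (r i) xk" x] by (simp add: e_def)
  qed
  have e_le: "e i \<le> \<beta>_r i / 2 * q" if "i \<in> N" for i
  proof -
    have "\<bar>e i\<bar> \<le> \<beta>_r i / 2 * q"
      unfolding e_def q_def using that N r_smooth
      by (intro abs_gradient_linearization_error_le) auto
    then show ?thesis by simp
  qed

  have E_le: "E \<le> 0"
    unfolding E_def
    by (intro sum_nonpos mult_nonpos_nonneg) (auto simp: N_def intro: e_nonneg)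

  have E_ge: "- (L_s * \<beta>_R / 2 * q) \<le> E"
  proof (cases "I_neg = {}")
    case True
    then show ?thesis using N by (simp add: E_def \<beta>_R)
  next
    case False
    have w_le: "norm w \<le> L_s"
      using s_bound[OF False] xk by (auto simp: w_def R_def X0(1) initial_level_set_def)
    \<comment> \<open>Cauchy-Schwarz, after enlarging \<open>N\<close>, the negative indices at \<open>xk\<close>, to the negative
      indices over the whole level set, since \<open>\<beta>_R\<close> is taken over the latter.\<close>
    have "(\<Sum>i\<in>N. \<bar>w $ i\<bar> * \<beta>_r i) \<le> (\<Sum>i\<in>N. \<bar>w $ i\<bar> * \<bar>\<beta>_r i\<bar>)"
      by (intro sum_mono mult_left_mono) auto
    also have "\<dots> \<le> (\<Sum>i\<in>I_neg. \<bar>w $ i\<bar> * \<bar>\<beta>_r i\<bar>)"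
      using N by (intro sum_mono2) auto
    also have "\<dots> \<le> L2_set (($) w) I_neg * \<beta>_R"
      unfolding \<beta>_R by (rule L2_set_mult_ineq)
    also have "\<dots> \<le> L_s * \<beta>_R"
    proof (rule mult_right_mono)
      have "L2_set (($) w) I_neg \<le> norm w"
        unfolding norm_vec_def L2_set_def by (auto intro: sum_mono2)
      with w_le show "L2_set (($) w) I_neg \<le> L_s" by simp
    qed (simp add: \<beta>_R)
    finally have weights: "(\<Sum>i\<in>N. \<bar>w $ i\<bar> * \<beta>_r i) \<le> L_s * \<beta>_R" .

    have "- E = (\<Sum>i\<in>N. \<bar>w $ i\<bar> * e i)"
      unfolding E_def sum_negf[symmetric] by (intro sum.cong) (auto simp: N_def)
    also have "\<dots> \<le> (\<Sum>i\<in>N. \<bar>w $ i\<bar> * (\<beta>_r i / 2 * q))"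
      by (intro sum_mono mult_left_mono e_le) auto
    also have "\<dots> = (\<Sum>i\<in>N. \<bar>w $ i\<bar> * \<beta>_r i) * (q / 2)"
      unfolding sum_distrib_right by (intro sum.cong) auto
    also have "\<dots> \<le> L_s * \<beta>_R * (q / 2)"
      using weights q by (intro mult_right_mono) auto
    finally show ?thesis by simp
  qed

  have "- (L_L / 2) * q = - (L_h * \<beta>_C / 2 * q) - L_R\<^sup>2 * \<beta>_s / 2 * q - L_s * \<beta>_R / 2 * q"
    "L_U / 2 * q = L_h * \<beta>_C / 2 * q + L_R\<^sup>2 * \<beta>_s / 2 * q"
    by (simp_all add: L_L L_U add_divide_distrib distrib_right left_diff_distrib)
  then have "- (L_L / 2) * q \<le> A + B + E" "A + B + E \<le> L_U / 2 * q"
    using A B E_le E_ge by linarith+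
  then show "ereal (- (L_L / 2) * (norm (x - xk))\<^sup>2) \<le> F x - model g h C s r xk x \<and>
      F x - model g h C s r xk x \<le> ereal (L_U / 2 * (norm (x - xk))\<^sup>2)"
    unfolding error q_def by simp
qed

end
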